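(* Let $f=\{f_1,\ldots,f_k\}$ be a set of polynomials in the ring $\mathbb{R}[x_1,\ldots,x_n]$ with $V_{\mathbb{R}}(f)\neq\emptyset$. For any $\beta>0$, there exists an open set in $\mathbb{R}^n$ containing $V_{\mathbb{R}}(f)$ such that for any point $a$ in this set there is a unique point on $V_{\mathbb{R}}(h)$ minimizing the distance from $(a,0)\in\mathbb{R}^{n+k}$ to $V_{\mathbb{R}}(h)$, where $h=\{f_1+w_1/\sqrt{\beta},\ldots,f_k+w_k/\sqrt{\beta}\}$. Moreover, if $a$ moves along some piecewise smooth curve $\mathcal{C}$ in this set, the corresponding projection trajectory can be obtained by solving the equation $$x+\beta\cdot\mathcal{J}^t\cdot f=a$$ continuously from an initial point $a_0\in\mathcal{C}$.
   Context: $V_{\mathbb{R}}(\cdot)$ denotes the set of common real zeros of a polynomial system; $x=(x_1,\ldots,x_n)$, and $w_1,\ldots,w_k$ are additional real variables, so that $h\subset\mathbb{R}[x_1,\ldots,x_n,w_1,\ldots,w_k]$ and $V_{\mathbb{R}}(h)\subseteq\mathbb{R}^{n+k}$. Distance is Euclidean distance. $\mathcal{J}=(\partial f_i/\partial x_j)$ is the $k\times n$ Jacobian matrix of $f$ with respect to $x$, $\mathcal{J}^t$ is its transpose, and in the equation $x+\beta\cdot\mathcal{J}^t\cdot f=a$ (with unknown $x$ and parameter $a$) the system $f$ is regarded as the column vector $(f_1,\ldots,f_k)^t$ evaluated at $x$. The projection of a point $a$ refers to the distance-minimizing point on $V_{\mathbb{R}}(h)$ for $(a,0)$, whose $x$-component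 is tracked by solving the equation. *)

theory Defs
  imports "HOL-Analysis.Analysis"
begin

text \<open>
  A system of \<open>k\<close> polynomials in \<open>n\<close> real variables is a map
  \<open>f :: real ^ 'n \<Rightarrow> real ^ 'k\<close> with polynomial components; over the (infinite) field of reals,
  polynomials and polynomial functions are the same thing.
\<close>

definition polynomial_system :: "('a::real_normed_vector \<Rightarrow> real ^ 'k) \<Rightarrow> bool"
  where "polynomial_system f \<longleftrightarrow> (\<forall>i. real_polynomial_function (\<lambda>x. f x $ i))"

definition real_zeros :: "('a \<Rightarrow> real ^ 'k) \<Rightarrow> 'a set"
  where "real_zeros f = {x. \<forall>i. f x $ i = 0}"

text \<open>
  The system \<open>h\<close> in the variables \<open>(x, w)\<close>. The space of dimension \<open>n + k\<close> is the product type
  \<open>(real ^ 'n) \<times> (real ^ 'k)\<close>, whose library metric is the Euclidean one.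
\<close>

definition slack_system ::
    "real \<Rightarrow> (real ^ 'n \<Rightarrow> real ^ 'k) \<Rightarrow> (real ^ 'n) \<times> (real ^ 'k) \<Rightarrow> real ^ 'k"
  where "slack_system \<beta> f = (\<lambda>(x, w). \<chi> i. f x $ i + w $ i / sqrt \<beta>)"

lemma polynomial_system_slack_system:
  fixes f :: "real ^ 'n \<Rightarrow> real ^ 'k"
  assumes "polynomial_system f"
  shows "polynomial_system (slack_system \<beta> f)"
  unfolding polynomial_system_def
proof
  fix i
  have "polynomial_function (fst :: (real ^ 'n) \<times> (real ^ 'k) \<Rightarrow> _)"
    by (simp add: polynomial_function_bounded_linear bounded_linear_fst)
  moreover have "real_polynomial_function (\<lambda>x. f x $ i)"
    using assms by (simp add: polynomial_system_def)
  ultimately have f: "real_polynomial_function (\<lambda>z::(real ^ 'n) \<times> (real ^ 'k). f (fst z) $ i)"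
    using real_polynomial_function_compose[of fst "\<lambda>x. f x $ i"] by (simp add: o_def)
  have w: "real_polynomial_function
      (\<lambda>z::(real ^ 'n) \<times> (real ^ 'k). snd z $ i * (1 / sqrt \<beta>))"
    by (intro real_polynomial_function.intros bounded_linear_mult_const
          bounded_linear_compose[OF bounded_linear_vec_nth bounded_linear_snd])
  show "real_polynomial_function (\<lambda>z. slack_system \<beta> f z $ i)"
    using real_polynomial_function.intros(3)[OF f w]
    by (simp add: slack_system_def case_prod_unfold)
qed

text \<open>The left-hand side \<open>x + \<beta> \<cdot> J\<^sup>t \<cdot> f\<close> of the tracking equation, evaluated at \<open>x\<close>.\<close>

definition tracking_map :: "real \<Rightarrow> (real ^ 'n \<Rightarrow> real ^ 'k) \<Rightarrow> real ^ 'n \<Rightarrow> real ^ 'n"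
  where "tracking_map \<beta> f x = x + \<beta> *\<^sub>R (transpose (jacobian f (at x)) *v f x)"

text \<open>
  The \<open>x\<close>-component of the distance-minimizing point on the zero set of \<open>h\<close> for \<open>(a, 0)\<close>.
  It is determined by \<open>a\<close> only if that minimizer is unique (\<open>closest_point\<close> is a choice).
\<close>

definition slack_projection :: "real \<Rightarrow> (real ^ 'n \<Rightarrow> real ^ 'k) \<Rightarrow> real ^ 'n \<Rightarrow> real ^ 'n"
  where "slack_projection \<beta> f a = fst (closest_point (real_zeros (slack_system \<beta> f)) (a, 0))"

text \<open>
  Solving the tracking equation continuously along the curve \<open>\<gamma>\<close> on \<open>[0,1]\<close>, starting at parameter
  \<open>t\<^sub>0\<close> from the solution \<open>x\<^sub>0\<close>, yields the trajectory \<open>p\<close>: it is a continuous solution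
  with this initial value, and every such solution agrees with it.
\<close>

definition tracks_to ::
    "real \<Rightarrow> (real ^ 'n \<Rightarrow> real ^ 'k) \<Rightarrow> (real \<Rightarrow> real ^ 'n) \<Rightarrow> real \<Rightarrow> real ^ 'n \<Rightarrow>
      (real \<Rightarrow> real ^ 'n) \<Rightarrow> bool"
  where "tracks_to \<beta> f \<gamma> t\<^sub>0 x\<^sub>0 p \<longleftrightarrow>
    (let sol = (\<lambda>x. continuous_on {0..1} x \<and> x t\<^sub>0 = x\<^sub>0 \<and>
                    (\<forall>t\<in>{0..1}. tracking_map \<beta> f (x t) = \<gamma> t))
     in sol p \<and> (\<forall>x. sol x \<longrightarrow> (\<forall>t\<in>{0..1}. x t = p t)))"

end

theory Submission
  imports Defs
begin

text \<open>
  The zero set of \<open>h\<close> is the graph of \<open>x \<mapsto> - sqrt \<beta> *\<^sub>R f x\<close>, and a point of it above \<open>x\<close> has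
  squared distance \<open>E\<^sub>a x = (dist a x)\<^sup>2 + \<beta> * (norm (f x))\<^sup>2\<close> to \<open>(a, 0)\<close>. The map
  \<open>T x = x + \<beta> \<cdot> J\<^sup>t \<cdot> f\<close> satisfies \<open>\<nabla>E\<^sub>a x = 2 (T x - a)\<close>, so every nearest point solves
  \<open>T x = a\<close> (\<open>nearest_point_solves_tracking\<close>).

  The derivative of \<open>T\<close> at \<open>z\<close> is the identity plus \<open>\<beta> J\<^sup>t J\<close>, which is positive semidefinite, plus
  \<open>\<beta>\<close> times the combination of the Hessians of the \<open>f\<^sub>i\<close> with weights \<open>f\<^sub>i z\<close>. The weights vanish at a zero
  \<open>v\<close> of \<open>f\<close>, so near \<open>v\<close> the last term is small and \<open>T\<close> is strongly monotone with constant \<open>1 / 2\<close>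
  (\<open>tracking_map_locally_strongly_monotone\<close>). By the Cauchy-Schwarz inequality \<open>T\<close> is then injective
  there and its inverse is Lipschitz.

  If \<open>T\<close> is strongly monotone on the ball of radius \<open>2 r\<close> about \<open>v\<close>, then the ball of radius \<open>r\<close>
  is put into \<open>U\<close>. For \<open>a\<close> in it, a nearest point with first component \<open>x\<close> satisfies
  \<open>dist a x \<le> dist a v < r\<close>, because \<open>(v, 0)\<close> is itself on the graph. Hence \<open>x\<close> is in the larger
  ball, where \<open>T x = a\<close> determines it, and it depends on \<open>a\<close> in a Lipschitz way. Along a curve in \<open>U\<close>
  the projection is therefore a continuous solution of the tracking equation. Any other continuous
  solution that agrees with it at one parameter agrees with it everywhere, as \<open>T\<close> is injective near
  each point of the projected curve (\<open>lift_unique_of_locally_injective\<close>).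
\<close>

section \<open>First and second derivatives of polynomials\<close>

text \<open>
  The gradient is returned as a polynomial map, so that the result can be applied again to the
  components of the gradient.
\<close>

lemma real_polynomial_function_gradient:
  fixes p :: "'a::euclidean_space \<Rightarrow> real"
  assumes "real_polynomial_function p"
  shows "\<exists>g. polynomial_function g \<and> (\<forall>x. (p has_derivative (\<lambda>h. g x \<bullet> h)) (at x))"
  using assms
proof (induction p rule: real_polynomial_function.induct)
  case (linear p)
  then have "p h = adjoint p 1 \<bullet> h" for h
    by (simp add: adjoint_clauses bounded_linear.linear inner_commute)
  then have "p = (\<lambda>h. adjoint p 1 \<bullet> h)"
    by blast
  then show ?case
    using bounded_linear.has_derivative[OF linear has_derivative_ident]
    by (intro exI[of _ "\<lambda>_. adjoint p 1"]) auto
next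
  case (const c)
  then show ?case
    by (intro exI[of _ "\<lambda>_. 0"]) auto
next
  case (add p q)
  then obtain g g'
    where g: "polynomial_function g" "\<And>x. (p has_derivative (\<lambda>h. g x \<bullet> h)) (at x)"
      and g': "polynomial_function g'" "\<And>x. (q has_derivative (\<lambda>h. g' x \<bullet> h)) (at x)"
    by blast
  then show ?case
    by (intro exI[of _ "\<lambda>x. g x + g' x"])
       (auto simp: inner_add_left intro!: has_derivative_add)
next
  case (mult p q)
  then obtain g g'
    where g: "polynomial_function g" "\<And>x. (p has_derivative (\<lambda>h. g x \<bullet> h)) (at x)"
      and g': "polynomial_function g'" "\<And>x. (q has_derivative (\<lambda>h. g' x \<bullet> h)) (at x)"
    by blast
  have "polynomial_function (\<lambda>x. p x *\<^sub>R g' x + q x *\<^sub>R g x)"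
    using mult.hyps g(1) g'(1) by (auto simp: real_polynomial_function_eq)
  moreover have "((\<lambda>x. p x * q x) has_derivative
      (\<lambda>h. (p x *\<^sub>R g' x + q x *\<^sub>R g x) \<bullet> h)) (at x)" for x
    using has_derivative_mult[OF g(2) g'(2), of x]
    by (simp add: inner_add_left mult.commute)
  ultimately show ?case
    by blast
qed

text \<open>
  Of the second derivative only its quadratic form matters below, and of the form only
  a bound that varies continuously with the base point.
\<close>

lemma real_polynomial_function_hessian:
  fixes p :: "'a::euclidean_space \<Rightarrow> real"
  assumes "real_polynomial_function p"
  shows "\<exists>g H N. (\<forall>x. (p has_derivative (\<lambda>h. g x \<bullet> h)) (at x)) \<and>
    (\<forall>x. (g has_derivative H x) (at x)) \<and> continuous_on UNIV N \<and>
    (\<forall>x h. \<bar>H x h \<bullet> h\<bar> \<le> N x * (norm h)\<^sup>2)"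
proof -
  obtain g where g: "polynomial_function g" "\<And>x. (p has_derivative (\<lambda>h. g x \<bullet> h)) (at x)"
    using real_polynomial_function_gradient[OF assms] by blast
  have "real_polynomial_function (\<lambda>x. g x \<bullet> b)" for b
    using g(1) bounded_linear_inner_left[of b] by (auto simp: polynomial_function_def o_def)
  then have "\<forall>b. \<exists>G. polynomial_function G \<and>
      (\<forall>x. ((\<lambda>x. g x \<bullet> b) has_derivative (\<lambda>h. G x \<bullet> h)) (at x))"
    using real_polynomial_function_gradient by blast
  then obtain G where G: "\<And>b. polynomial_function (G b)"
      "\<And>b x. ((\<lambda>x. g x \<bullet> b) has_derivative (\<lambda>h. G b x \<bullet> h)) (at x)"
    by metis
  define H where "H x h = (\<Sum>b\<in>Basis. (G b x \<bullet> h) *\<^sub>R b)" for x h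
  define N where "N x = (\<Sum>b\<in>Basis. norm (G b x))" for x
  have "(g has_derivative H x) (at x)" for x
    using G(2) by (subst has_derivative_componentwise_within) (simp add: H_def)
  moreover have "continuous_on UNIV N"
    unfolding N_def by (intro continuous_intros continuous_on_polymonial_function G)
  moreover have "\<bar>H x h \<bullet> h\<bar> \<le> N x * (norm h)\<^sup>2" for x h
  proof -
    have "\<bar>H x h \<bullet> h\<bar> \<le> (\<Sum>b\<in>Basis. \<bar>(G b x \<bullet> h) * (h \<bullet> b)\<bar>)"
      by (simp add: H_def inner_sum_right inner_commute[of _ h])
    also have "\<dots> \<le> (\<Sum>b\<in>Basis. norm (G b x) * norm h * norm h)"
      unfolding abs_mult
      by (intro sum_mono mult_mono Cauchy_Schwarz_ineq2)
         (auto simp: Basis_le_norm)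
    finally show ?thesis
      by (simp add: N_def sum_distrib_right power2_eq_square mult.assoc)
  qed
  ultimately show ?thesis
    using g(2) by blast
qed

lemma polynomial_system_derivatives:
  fixes f :: "'a::euclidean_space \<Rightarrow> real ^ 'k"
  assumes "polynomial_system f"
  obtains g H N where
    "\<And>i x. ((\<lambda>x. f x $ i) has_derivative (\<lambda>h. g i x \<bullet> h)) (at x)"
    "\<And>i x. (g i has_derivative H i x) (at x)"
    "\<And>i. continuous_on UNIV (N i)"
    "\<And>i x h. \<bar>H i x h \<bullet> h\<bar> \<le> N i x * (norm h)\<^sup>2"
proof -
  have "\<forall>i. \<exists>g H N. (\<forall>x. ((\<lambda>x. f x $ i) has_derivative (\<lambda>h. g x \<bullet> h)) (at x)) \<and>
      (\<forall>x. (g has_derivative H x) (at x)) \<and> continuous_on UNIV N \<and>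
      (\<forall>x h. \<bar>H x h \<bullet> h\<bar> \<le> N x * (norm h)\<^sup>2)"
    using assms real_polynomial_function_hessian unfolding polynomial_system_def by blast
  then show ?thesis
    using that by metis
qed

section \<open>Strong monotonicity near the zeros\<close>

lemma tracking_map_eq:
  fixes f :: "real ^ 'n \<Rightarrow> real ^ 'k"
  assumes g: "\<And>i. ((\<lambda>x. f x $ i) has_derivative (\<lambda>h. g i x \<bullet> h)) (at x)"
  shows "tracking_map \<beta> f x = x + \<beta> *\<^sub>R (\<Sum>i\<in>UNIV. f x $ i *\<^sub>R g i x)"
proof -
  have "(f has_derivative (\<lambda>h. \<chi> i. g i x \<bullet> h)) (at x)"
    using g by (subst has_derivative_componentwise_within)
      (auto simp: Basis_vec_def inner_axis)
  then have "frechet_derivative f (at x) = (\<lambda>h. \<chi> i. g i x \<bullet> h)"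
    by (metis frechet_derivative_at)
  then have "transpose (jacobian f (at x)) *v f x = (\<Sum>i\<in>UNIV. f x $ i *\<^sub>R g i x)"
    by (simp add: vec_eq_iff jacobian_def matrix_def transpose_def matrix_vector_mult_def
        inner_axis mult.commute)
  then show ?thesis
    by (simp add: tracking_map_def)
qed

text \<open>
  The quadratic form of the derivative of the tracking map is
  \<open>(norm h)\<^sup>2 + \<beta> * (\<Sum>i. f\<^sub>i z * (H\<^sub>i z h \<bullet> h) + (g\<^sub>i z \<bullet> h)\<^sup>2)\<close>, with \<open>g\<^sub>i\<close> the gradient and \<open>H\<^sub>i\<close> the Hessian of
  \<open>f\<^sub>i\<close>. The squares only help, and the Hessian terms carry factors that vanish at \<open>v\<close>, so near \<open>v\<close>
  the form is at least \<open>(norm h)\<^sup>2 / 2\<close>. The mean value theorem on a segment turns this into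
  monotonicity.
\<close>

lemma tracking_map_locally_strongly_monotone:
  fixes f :: "real ^ 'n \<Rightarrow> real ^ 'k"
  assumes f: "polynomial_system f" and v: "v \<in> real_zeros f" and "\<beta> > 0"
  shows "\<exists>r>0. \<forall>x\<in>ball v r. \<forall>y\<in>ball v r.
    (norm (x - y))\<^sup>2 / 2 \<le> (tracking_map \<beta> f x - tracking_map \<beta> f y) \<bullet> (x - y)"
proof -
  obtain g H N
    where g: "\<And>i x. ((\<lambda>x. f x $ i) has_derivative (\<lambda>h. g i x \<bullet> h)) (at x)"
      and H: "\<And>i x. (g i has_derivative H i x) (at x)"
      and N: "\<And>i. continuous_on UNIV (N i)"
      and HN: "\<And>i x h. \<bar>H i x h \<bullet> h\<bar> \<le> N i x * (norm h)\<^sup>2"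
    using polynomial_system_derivatives[OF f] by blast
  have T: "tracking_map \<beta> f = (\<lambda>x. x + \<beta> *\<^sub>R (\<Sum>i\<in>UNIV. f x $ i *\<^sub>R g i x))"
    using tracking_map_eq[of f] g by blast
  define T' where
    "T' z h = h + \<beta> *\<^sub>R (\<Sum>i\<in>UNIV. f z $ i *\<^sub>R H i z h + (g i z \<bullet> h) *\<^sub>R g i z)" for z h
  have dT: "(tracking_map \<beta> f has_derivative T' z) (at z)" for z
    unfolding T T'_def by (intro derivative_intros g H)
  \<comment> \<open>\<open>M z\<close> bounds the Hessian part of the quadratic form at \<open>z\<close>; the zero \<open>v\<close> makes it vanish.\<close>
  define M where "M z = \<beta> * (\<Sum>i\<in>UNIV. \<bar>f z $ i\<bar> * N i z)" for z
  have T'_ge: "(1 - M z) * (norm h)\<^sup>2 \<le> T' z h \<bullet> h" for z h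
  proof -
    have "- (\<bar>f z $ i\<bar> * N i z * (norm h)\<^sup>2) \<le> f z $ i * (H i z h \<bullet> h) + (g i z \<bullet> h) * (g i z \<bullet> h)"
      for i
    proof -
      have "\<bar>f z $ i * (H i z h \<bullet> h)\<bar> \<le> \<bar>f z $ i\<bar> * (N i z * (norm h)\<^sup>2)"
        unfolding abs_mult by (intro mult_left_mono HN) auto
      moreover have "0 \<le> (g i z \<bullet> h) * (g i z \<bullet> h)"
        by simp
      ultimately show ?thesis
        by (simp only: mult.assoc)
    qed
    then have "(\<Sum>i\<in>UNIV. - (\<bar>f z $ i\<bar> * N i z * (norm h)\<^sup>2)) \<le>
        (\<Sum>i\<in>UNIV. f z $ i * (H i z h \<bullet> h) + (g i z \<bullet> h) * (g i z \<bullet> h))"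
      by (intro sum_mono)
    then have "\<beta> * (\<Sum>i\<in>UNIV. - (\<bar>f z $ i\<bar> * N i z * (norm h)\<^sup>2)) \<le>
        \<beta> * (\<Sum>i\<in>UNIV. f z $ i * (H i z h \<bullet> h) + (g i z \<bullet> h) * (g i z \<bullet> h))"
      using \<open>\<beta> > 0\<close> by simp
    moreover have "\<beta> * (\<Sum>i\<in>UNIV. - (\<bar>f z $ i\<bar> * N i z * (norm h)\<^sup>2)) = - (M z * (norm h)\<^sup>2)"
      by (simp add: M_def sum_negf sum_distrib_right mult.assoc)
    moreover have "T' z h \<bullet> h = (norm h)\<^sup>2 +
        \<beta> * (\<Sum>i\<in>UNIV. f z $ i * (H i z h \<bullet> h) + (g i z \<bullet> h) * (g i z \<bullet> h))"
      by (simp add: T'_def inner_add_left inner_sum_left power2_norm_eq_inner)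
    ultimately show ?thesis
      by (simp add: left_diff_distrib)
  qed
  have "continuous_on UNIV (\<lambda>z. f z $ i)" for i
    using g has_derivative_continuous_on by (metis has_derivative_at_withinI)
  then have "continuous_on UNIV (\<lambda>z. \<chi> i. f z $ i)"
    by (intro continuous_on_vec_lambda)
  then have "continuous_on UNIV f"
    by simp
  then have "continuous_on UNIV M"
    unfolding M_def by (intro continuous_intros N)
  then have "open {z. M z < 1 / 2}"
    by (intro open_Collect_less continuous_intros)
  moreover have "M v = 0"
    using v by (simp add: M_def real_zeros_def)
  ultimately obtain r where "r > 0" and r: "\<And>z. z \<in> ball v r \<Longrightarrow> M z < 1 / 2"
    by (metis (mono_tags, lifting) divide_pos_pos mem_Collect_eq openE subset_eq
        zero_less_numeral zero_less_one)
  have "(norm (x - y))\<^sup>2 / 2 \<le> (tracking_map \<beta> f x - tracking_map \<beta> f y) \<bullet> (x - y)"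
    if xy: "x \<in> ball v r" "y \<in> ball v r" for x y
  proof -
    define d where "d = x - y"
    define \<phi> where "\<phi> s = tracking_map \<beta> f (y + s *\<^sub>R d) \<bullet> d" for s
    have "(\<phi> has_derivative (\<lambda>t. T' (y + s *\<^sub>R d) (t *\<^sub>R d) \<bullet> d)) (at s within {0..1})" for s
      unfolding \<phi>_def
      by (rule has_derivative_inner_left[OF has_derivative_compose[OF _ dT]])
         (auto intro!: derivative_eq_intros)
    then obtain s where s: "s \<in> {0..1}" "\<phi> 1 - \<phi> 0 = T' (y + s *\<^sub>R d) d \<bullet> d"
      using mvt_very_simple[of 0 1 \<phi> "\<lambda>s t. T' (y + s *\<^sub>R d) (t *\<^sub>R d) \<bullet> d"] by auto
    have "y + s *\<^sub>R d = (1 - s) *\<^sub>R y + s *\<^sub>R x"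
      by (simp add: d_def algebra_simps)
    then have "y + s *\<^sub>R d \<in> ball v r"
      using convexD_alt[OF convex_ball xy(2,1), of s] s(1) by simp
    then have "M (y + s *\<^sub>R d) < 1 / 2"
      by (rule r)
    then have "1 / 2 * (norm d)\<^sup>2 \<le> (1 - M (y + s *\<^sub>R d)) * (norm d)\<^sup>2"
      by (intro mult_right_mono) auto
    also have "\<dots> \<le> \<phi> 1 - \<phi> 0"
      using T'_ge s(2) by simp
    finally show ?thesis
      by (simp add: \<phi>_def d_def inner_diff_left)
  qed
  with \<open>r > 0\<close> show ?thesis
    by blast
qed

section \<open>Nearest points on the graph\<close>

lemma mem_slack_system_iff:
  assumes "\<beta> > 0"
  shows "(x, w) \<in> real_zeros (slack_system \<beta> f) \<longleftrightarrow> w = - sqrt \<beta> *\<^sub>R f x"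
proof -
  have "f x $ i + w $ i / sqrt \<beta> = 0 \<longleftrightarrow> w $ i = - sqrt \<beta> * f x $ i" for i
    using assms by (auto simp: field_simps)
  then show ?thesis
    by (simp add: real_zeros_def slack_system_def vec_eq_iff)
qed

lemma dist_graph_square:
  assumes "\<beta> \<ge> 0"
  shows "(dist (a, 0) (x, - sqrt \<beta> *\<^sub>R f x))\<^sup>2 = (dist a x)\<^sup>2 + \<beta> * (norm (f x))\<^sup>2"
  using assms by (simp add: dist_Pair_Pair power_mult_distrib)

text \<open>
  The tracking equation is the vanishing of the gradient of the squared distance to \<open>(a, 0)\<close> along
  the graph.
\<close>

lemma nearest_point_solves_tracking:
  fixes f :: "real ^ 'n \<Rightarrow> real ^ 'k"
  assumes f: "polynomial_system f"
    and min: "\<And>y. (dist a x)\<^sup>2 + \<beta> * (norm (f x))\<^sup>2 \<le> (dist a y)\<^sup>2 + \<beta> * (norm (f y))\<^sup>2"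
  shows "tracking_map \<beta> f x = a"
proof -
  have "\<forall>i. \<exists>g. \<forall>x. ((\<lambda>x. f x $ i) has_derivative (\<lambda>h. g x \<bullet> h)) (at x)"
    using f real_polynomial_function_gradient unfolding polynomial_system_def by blast
  then obtain g where g: "\<And>i x. ((\<lambda>x. f x $ i) has_derivative (\<lambda>h. g i x \<bullet> h)) (at x)"
    by metis
  define E where "E y = (y - a) \<bullet> (y - a) + \<beta> * (\<Sum>i\<in>UNIV. f y $ i * f y $ i)" for y
  have E: "E y = (dist a y)\<^sup>2 + \<beta> * (norm (f y))\<^sup>2" for y
    unfolding E_def dist_commute[of a] dist_norm power2_norm_eq_inner inner_vec_def[of "f y"]
    by (simp add: inner_diff_left inner_diff_right)
  have "(E has_derivative (\<lambda>h. 2 * ((tracking_map \<beta> f x - a) \<bullet> h))) (at x)"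
  proof -
    have "((\<lambda>y. y - a) has_derivative (\<lambda>h. h)) (at x)"
      by (auto intro!: derivative_eq_intros)
    then have "(E has_derivative (\<lambda>h. ((x - a) \<bullet> h + h \<bullet> (x - a)) +
        \<beta> * (\<Sum>i\<in>UNIV. f x $ i * (g i x \<bullet> h) + (g i x \<bullet> h) * f x $ i))) (at x)"
      unfolding E_def
      by (intro has_derivative_add has_derivative_inner has_derivative_mult_right
          has_derivative_sum has_derivative_mult g)
    moreover have "((x - a) \<bullet> h + h \<bullet> (x - a)) +
        \<beta> * (\<Sum>i\<in>UNIV. f x $ i * (g i x \<bullet> h) + (g i x \<bullet> h) * f x $ i) =
        2 * ((tracking_map \<beta> f x - a) \<bullet> h)" for h
      unfolding tracking_map_eq[where f = f and g = g, OF g]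
      by (simp add: inner_add_left inner_diff_left inner_sum_left sum_distrib_left
          inner_commute[of h] mult.commute[of "_ \<bullet> _" "_ $ _"] mult.left_commute[of \<beta>])
    ultimately show ?thesis
      by simp
  qed
  then have "(\<lambda>h. 2 * ((tracking_map \<beta> f x - a) \<bullet> h)) = (\<lambda>h. 0)"
    using min by (intro differential_zero_maxmin[of x UNIV E]) (auto simp: E)
  then have "(tracking_map \<beta> f x - a) \<bullet> (tracking_map \<beta> f x - a) = 0"
    by (metis mult_eq_0_iff zero_neq_numeral)
  then show ?thesis
    by simp
qed

section \<open>Unique continuation of solutions\<close>

text \<open>
  The set where \<open>p\<close> and \<open>q\<close> agree is closed by continuity. It is open because near a point of
  agreement both functions take values in one set \<open>W\<close> on which \<open>T\<close> is injective.
\<close>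

lemma lift_unique_of_locally_injective:
  fixes p q :: "'a::topological_space \<Rightarrow> 'b::metric_space"
  assumes S: "connected S" "t\<^sub>0 \<in> S" and p: "continuous_on S p" and q: "continuous_on S q"
    and eq: "p t\<^sub>0 = q t\<^sub>0" "\<And>t. t \<in> S \<Longrightarrow> T (p t) = T (q t)"
    and inj: "\<And>t. t \<in> S \<Longrightarrow> \<exists>W. open W \<and> q t \<in> W \<and> inj_on T W"
    and "t \<in> S"
  shows "p t = q t"
proof -
  define A where "A = {t \<in> S. p t = q t}"
  have "A = {t \<in> S. dist (p t) (q t) = 0}"
    by (auto simp: A_def)
  then have "closedin (top_of_set S) A"
    using continuous_closedin_preimage_constant[OF continuous_on_dist[OF p q], of 0] by simp
  moreover have "openin (top_of_set S) A"
  proof (subst openin_subopen, intro ballI)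
    fix t assume t: "t \<in> A"
    then obtain W where W: "open W" "q t \<in> W" "inj_on T W"
      using inj by (auto simp: A_def)
    have "openin (top_of_set S) ((S \<inter> p -` W) \<inter> (S \<inter> q -` W))"
      using p q W(1) by (intro openin_Int continuous_openin_preimage_gen)
    moreover have "(S \<inter> p -` W) \<inter> (S \<inter> q -` W) \<subseteq> A"
      using W(3) eq(2) by (auto simp: A_def inj_on_def)
    moreover have "t \<in> (S \<inter> p -` W) \<inter> (S \<inter> q -` W)"
      using t W(2) by (auto simp: A_def)
    ultimately show "\<exists>V. openin (top_of_set S) V \<and> t \<in> V \<and> V \<subseteq> A"
      by blast
  qed
  moreover have "t\<^sub>0 \<in> A"
    using S(2) eq(1) by (simp add: A_def)
  ultimately have "A = S"
    using S(1) unfolding connected_clopen by blast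
  then show ?thesis
    using \<open>t \<in> S\<close> by (auto simp: A_def)
qed

section \<open>The projection and its trajectories\<close>

theorem theorem6p4:
  fixes f :: "real ^ 'n \<Rightarrow> real ^ 'k" and \<beta> :: real
  assumes "polynomial_system f"
    and "real_zeros f \<noteq> {}"
    and "\<beta> > 0"
  shows "\<exists>U. open U \<and> real_zeros f \<subseteq> U \<and>
    (\<forall>a\<in>U. \<exists>!z. z \<in> real_zeros (slack_system \<beta> f) \<and>
        (\<forall>y\<in>real_zeros (slack_system \<beta> f). dist (a, 0) z \<le> dist (a, 0) y)) \<and>
    (\<forall>\<gamma>. valid_path \<gamma> \<and> path_image \<gamma> \<subseteq> U \<longrightarrow>
        (\<forall>t\<^sub>0\<in>{0..1}. tracks_to \<beta> f \<gamma> t\<^sub>0 (slack_projection \<beta> f (\<gamma> t\<^sub>0))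
            (\<lambda>t. slack_projection \<beta> f (\<gamma> t))))"
proof -
  define T where "T = tracking_map \<beta> f"
  define Z where "Z = real_zeros (slack_system \<beta> f)"
  define p where "p = slack_projection \<beta> f"
  define nearest where "nearest a z \<longleftrightarrow> z \<in> Z \<and> (\<forall>y\<in>Z. dist (a, 0) z \<le> dist (a, 0) y)" for a z
  have Z: "(x, w) \<in> Z \<longleftrightarrow> w = - sqrt \<beta> *\<^sub>R f x" for x w
    unfolding Z_def using mem_slack_system_iff[OF \<open>\<beta> > 0\<close>] .
  have nearest_energy: "(dist a (fst z))\<^sup>2 + \<beta> * (norm (f (fst z)))\<^sup>2
      \<le> (dist a y)\<^sup>2 + \<beta> * (norm (f y))\<^sup>2" if "nearest a z" for a z y
  proof -
    have z: "z = (fst z, - sqrt \<beta> *\<^sub>R f (fst z))"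
      using that Z[of "fst z" "snd z"] by (simp add: nearest_def prod_eq_iff)
    have "dist (a, 0) z \<le> dist (a, 0) (y, - sqrt \<beta> *\<^sub>R f y)"
      using that by (auto simp: nearest_def Z)
    then have "(dist (a, 0) z)\<^sup>2 \<le> (dist (a, 0) (y, - sqrt \<beta> *\<^sub>R f y))\<^sup>2"
      by (simp add: power_mono)
    then show ?thesis
      using dist_graph_square[of \<beta> a _ f] \<open>\<beta> > 0\<close> z by (metis less_imp_le)
  qed
  have nearest_solves: "T (fst z) = a" if "nearest a z" for a z
    unfolding T_def
    using nearest_point_solves_tracking[OF \<open>polynomial_system f\<close>] nearest_energy[OF that]
    by blast
  have "closed Z"
  proof -
    have "continuous_on UNIV (\<lambda>z. slack_system \<beta> f z $ i)" for i
      using polynomial_system_slack_system[OF \<open>polynomial_system f\<close>]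
      by (intro continuous_on_polymonial_function)
         (simp add: polynomial_system_def real_polynomial_function_eq)
    then show ?thesis
      unfolding Z_def real_zeros_def
      by (intro closed_Collect_all closed_Collect_eq) auto
  qed
  then have nearest_p: "\<exists>z. nearest a z \<and> fst z = p a" for a
    using closest_point_exists[of Z "(a, 0)"] Z
    unfolding nearest_def p_def slack_projection_def Z_def by blast
  \<comment> \<open>Monotonicity is needed on twice the radius that enters \<open>U\<close>: projecting a point within \<open>r\<close>
    of \<open>v\<close> can move it by up to \<open>r\<close>.\<close>
  have "\<exists>r>0. \<forall>x\<in>ball v (2 * r). \<forall>y\<in>ball v (2 * r). (norm (x - y))\<^sup>2 / 2 \<le> (T x - T y) \<bullet> (x - y)"
    if v: "v \<in> real_zeros f" for v
  proof -
    obtain r where "r > 0" "\<forall>x\<in>ball v r. \<forall>y\<in>ball v r.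
        (norm (x - y))\<^sup>2 / 2 \<le> (T x - T y) \<bullet> (x - y)"
      using tracking_map_locally_strongly_monotone[OF \<open>polynomial_system f\<close> v \<open>\<beta> > 0\<close>]
      unfolding T_def by blast
    then show ?thesis
      by (intro exI[of _ "r / 2"]) auto
  qed
  then obtain r where r: "\<And>v. v \<in> real_zeros f \<Longrightarrow> r v > 0"
    and mono: "\<And>v x y. \<lbrakk>v \<in> real_zeros f; x \<in> ball v (2 * r v); y \<in> ball v (2 * r v)\<rbrakk>
      \<Longrightarrow> (norm (x - y))\<^sup>2 / 2 \<le> (T x - T y) \<bullet> (x - y)"
    by metis
  have expand: "dist x y \<le> 2 * dist (T x) (T y)"
    if v: "v \<in> real_zeros f" "x \<in> ball v (2 * r v)" "y \<in> ball v (2 * r v)" for v x y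
  proof -
    have "norm (x - y) * norm (x - y) \<le> 2 * norm (T x - T y) * norm (x - y)"
      using mono[OF v] norm_cauchy_schwarz[of "T x - T y" "x - y"] by (simp add: power2_eq_square)
    then show ?thesis
      by (cases "x = y") (auto simp: dist_norm)
  qed
  then have inj: "inj_on T (ball v (2 * r v))" if "v \<in> real_zeros f" for v
    using that by (force simp: inj_on_def)
  define U where "U = (\<Union>v\<in>real_zeros f. ball v (r v))"
  have near: "fst z \<in> ball v (2 * r v)"
    if v: "v \<in> real_zeros f" and a: "a \<in> ball v (r v)" and z: "nearest a z" for v a z
  proof -
    have "f v = 0"
      using v by (simp add: real_zeros_def vec_eq_iff)
    then have "(dist a (fst z))\<^sup>2 + \<beta> * (norm (f (fst z)))\<^sup>2 \<le> (dist a v)\<^sup>2"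
      using nearest_energy[OF z, of v] by simp
    moreover have "0 \<le> \<beta> * (norm (f (fst z)))\<^sup>2"
      using \<open>\<beta> > 0\<close> by simp
    ultimately have "(dist a (fst z))\<^sup>2 \<le> (dist a v)\<^sup>2"
      by linarith
    then have "dist a (fst z) \<le> dist a v"
      by (simp add: power2_le_iff_abs_le)
    then show ?thesis
      using a dist_triangle[of v "fst z" a] by (simp add: dist_commute)
  qed
  have pT: "T (p a) = a" for a
    using nearest_p nearest_solves by metis
  have p_near: "p a \<in> ball v (2 * r v)" if "v \<in> real_zeros f" "a \<in> ball v (r v)" for v a
    using near[OF that] nearest_p by metis
  have "\<exists>!z. nearest a z" if a: "a \<in> U" for a
  proof -
    obtain v where v: "v \<in> real_zeros f" "a \<in> ball v (r v)"
      using a by (auto simp: U_def)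
    have "z = z'" if "nearest a z" "nearest a z'" for z z'
    proof -
      have "fst z = fst z'"
        using inj_onD[OF inj[OF v(1)] _ near[OF v that(1)] near[OF v that(2)]]
          nearest_solves[OF that(1)] nearest_solves[OF that(2)] by simp
      moreover have "snd z = - sqrt \<beta> *\<^sub>R f (fst z)" "snd z' = - sqrt \<beta> *\<^sub>R f (fst z')"
        using that Z[of "fst z" "snd z"] Z[of "fst z'" "snd z'"] by (simp_all add: nearest_def)
      ultimately show ?thesis
        by (simp add: prod_eq_iff)
    qed
    then show ?thesis
      using nearest_p by metis
  qed
  moreover have "tracks_to \<beta> f \<gamma> t\<^sub>0 (p (\<gamma> t\<^sub>0)) (\<lambda>t. p (\<gamma> t))"
    if \<gamma>: "valid_path \<gamma>" "path_image \<gamma> \<subseteq> U" and t\<^sub>0: "t\<^sub>0 \<in> {0..1}" for \<gamma> t\<^sub>0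
  proof -
    have "continuous_on (ball v (r v)) p" if v: "v \<in> real_zeros f" for v
    proof (rule lipschitz_on_continuous_on[OF lipschitz_onI])
      show "dist (p a) (p a') \<le> 2 * dist a a'" if "a \<in> ball v (r v)" "a' \<in> ball v (r v)" for a a'
        using expand[OF v p_near[OF v that(1)] p_near[OF v that(2)]] by (simp add: pT)
    qed simp
    then have "continuous_on U p"
      unfolding U_def by (intro continuous_on_open_UN) auto
    moreover have "continuous_on {0..1} \<gamma>"
      using valid_path_imp_path[OF \<gamma>(1)] by (simp add: path_def)
    ultimately have cont: "continuous_on {0..1} (\<lambda>t. p (\<gamma> t))"
      by (rule continuous_on_compose2) (use \<gamma>(2) in \<open>simp add: path_image_def\<close>)
    have "x t = p (\<gamma> t)"
      if x: "continuous_on {0..1} x" "x t\<^sub>0 = p (\<gamma> t\<^sub>0)" "\<forall>t\<in>{0..1}. T (x t) = \<gamma> t"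
        and t: "t \<in> {0..1}" for x t
    proof (rule lift_unique_of_locally_injective[OF _ t\<^sub>0 x(1) cont x(2) _ _ t, of T])
      show "\<exists>W. open W \<and> p (\<gamma> t) \<in> W \<and> inj_on T W" if t: "t \<in> {0..1}" for t
      proof -
        obtain v where "v \<in> real_zeros f" "\<gamma> t \<in> ball v (r v)"
          using \<gamma>(2) t unfolding path_image_def U_def by blast
        then show ?thesis
          using p_near inj by blast
      qed
    qed (use x(3) pT in auto)
    then show ?thesis
      using cont pT unfolding tracks_to_def Let_def T_def by blast
  qed
  moreover have "open U"
    by (auto simp: U_def)
  moreover have "real_zeros f \<subseteq> U"
    unfolding U_def using r by (meson UN_I centre_in_ball subsetI)
  ultimately show ?thesis
    unfolding nearest_def Z_def p_def by (intro exI[of _ U] conjI ballI allI impI) simp_all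
qed

end
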